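(* If $s\in l^{\infty}$ is a simply distributed sequence with finite range $\{a_1,\ldots,a_m\}$, then $s$ is almost convergent, with the unique Banach limit $L(s)=\sum_{j=1}^m a_j\,w(s,a_j)$.
   Context: $l^{\infty}$ is the Banach space of bounded real sequences $x=\{x(n)\}_{n=1}^{\infty}$ with norm $\|x\|_{\infty}=\sup_n|x(n)|$. A Banach limit is a bounded linear functional $L$ on $l^{\infty}$ such that: (a) $L(x)\ge 0$ whenever $x(n)\ge 0$ for all $n$; (b) $L(x)=L(Tx)$ where $Tx=\{x(2),x(3),\ldots\}$; (c) $L(1)=1$ where $1=\{1,1,\ldots\}$; (d) $\|L\|=1$; (e) $L(x)=\lim_{n\to\infty}x(n)$ if $x$ converges. A sequence $x\in l^\infty$ is almost convergent if $L(x)$ has the same value for all Banach limits $L$; this common value is its unique Banach limit. $A(E)$ denotes the cardinality of a set $E$. A sequence $s=\{s(n)\}_{n=1}^{\infty}\in l^{\infty}$ is called simply distributed if it takes finitely many values, with range $\{a_1,\ldots,a_m\}$ (the $a_j$ distinct), and for each $j=1,\ldots,m$ $$w(s,a_j)=\liminf_{n\to\infty}\frac{A(\{k: s(k+i)=a_j,\ k=0,1,\ldots,n-1\})}{n}=\limsup_{n\to\infty}\frac{A(\{k: s(k+i)=a_j,\ k=0,1,\ldots,n-1\})}{n}$$ exists uniformly in $i\in\mathbb{N}=\{1,2,\ldots\}$, i.e. the quotient converges as $n\to\infty$, uniformly in $i$, to a number $w(s,a_j)$ independent of $i$. The number $w(s,a_j)$ is called the weight of $s$ with respect to $a_j$.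 *)

theory Defs
  imports "HOL-Analysis.Analysis"
begin

text \<open>
  As \<^typ>\<open>nat\<close> carries the discrete topology, every bounded real sequence is a
  bounded continuous function, so \<^typ>\<open>nat \<Rightarrow>\<^sub>C real\<close> with its supremum norm is the
  Banach space of bounded real sequences.  Sequences are indexed from \<open>0\<close>: the term usually
  written \<open>x(n)\<close> with \<open>n \<ge> 1\<close> is \<open>x (n - 1)\<close> here, and shifts by \<open>i \<ge> 1\<close> become
  shifts by an arbitrary natural number.
\<close>

type_synonym linf = "nat \<Rightarrow>\<^sub>C real"

definition left_shift :: "linf \<Rightarrow> linf" where
  "left_shift x = Bcontfun (\<lambda>n. apply_bcontfun x (Suc n))"

lemma apply_left_shift [simp]: "apply_bcontfun (left_shift x) n = apply_bcontfun x (Suc n)"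
proof -
  have "bounded (range (\<lambda>n. apply_bcontfun x (Suc n)))"
    by (rule bounded_subset[OF bounded_apply_bcontfun[of x]]) auto
  then have "(\<lambda>n. apply_bcontfun x (Suc n)) \<in> bcontfun"
    by (simp add: bcontfun_def)
  then show ?thesis
    by (simp add: left_shift_def Bcontfun_inverse)
qed

definition banach_limit :: "(linf \<Rightarrow>\<^sub>L real) \<Rightarrow> bool" where
  "banach_limit L \<longleftrightarrow>
     (\<forall>x. (\<forall>n. apply_bcontfun x n \<ge> 0) \<longrightarrow> blinfun_apply L x \<ge> 0) \<and>
     (\<forall>x. blinfun_apply L x = blinfun_apply L (left_shift x)) \<and>
     blinfun_apply L (const_bcontfun 1) = 1 \<and>
     norm L = 1 \<and>
     (\<forall>x l. apply_bcontfun x \<longlonglongrightarrow> l \<longrightarrow> blinfun_apply L x = l)"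

definition almost_convergent :: "linf \<Rightarrow> bool" where
  "almost_convergent x \<longleftrightarrow>
     (\<forall>L L'. banach_limit L \<longrightarrow> banach_limit L' \<longrightarrow> blinfun_apply L x = blinfun_apply L' x)"

text \<open>
  The description is unique only because at least one Banach limit exists, so an equation
  for this value never holds vacuously.
\<close>

definition unique_banach_limit :: "linf \<Rightarrow> real" where
  "unique_banach_limit x = (THE c. \<forall>L. banach_limit L \<longrightarrow> blinfun_apply L x = c)"

definition window_freq :: "linf \<Rightarrow> real \<Rightarrow> nat \<Rightarrow> nat \<Rightarrow> real" where
  "window_freq s a n i = real (card {k. k < n \<and> apply_bcontfun s (k + i) = a}) / real n"

definition has_weight :: "linf \<Rightarrow> real \<Rightarrow> real \<Rightarrow> bool" where
  "has_weight s a w \<longleftrightarrow> uniform_limit UNIV (window_freq s a) (\<lambda>i. w) sequentially"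

lemma has_weight_unique:
  assumes "has_weight s a w" "has_weight s a w'"
  shows "w = w'"
proof -
  have "(\<lambda>n. window_freq s a n 0) \<longlonglongrightarrow> w" "(\<lambda>n. window_freq s a n 0) \<longlonglongrightarrow> w'"
    using assms unfolding has_weight_def by (auto dest: tendsto_uniform_limitI[where x = 0])
  then show ?thesis
    by (rule LIMSEQ_unique)
qed

definition weight :: "linf \<Rightarrow> real \<Rightarrow> real" where
  "weight s a = (THE w. has_weight s a w)"

definition simply_distributed :: "linf \<Rightarrow> bool" where
  "simply_distributed s \<longleftrightarrow>
     finite (range (apply_bcontfun s)) \<and>
     (\<forall>a \<in> range (apply_bcontfun s). \<exists>w. has_weight s a w)"

end

theory Submission
  imports Defs
begin

text \<open>
  Let \<open>L\<close> be a Banach limit and let \<open>y\<close> be the sequence of averages of \<open>s\<close> over windows of a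
  fixed length \<open>n\<close>.  Shift invariance and linearity give \<open>L(s) = L(y)\<close>
  (\<open>shift_invariant_window_mean\<close>).  Grouping the terms of a window by their value writes \<open>y\<close> as the
  combination of the window frequencies with coefficients \<open>a\<^sub>j\<close>.  The frequencies converge
  uniformly in the starting point of the window, so as \<open>n\<close> grows \<open>y\<close> converges in the supremum norm
  to the constant sequence \<open>c = \<Sum> a\<^sub>j w\<^sub>j\<close>, and continuity of \<open>L\<close> forces \<open>L(s) = c\<close>.  This is the
  easy half of Lorentz's characterisation of almost convergence
  (\<open>banach_limit_eq_uniform_window_mean_limit\<close>).

  The common value of all Banach limits at \<open>s\<close> is only determined if Banach limits exist
  (\<open>banach_limit_exists\<close>).  To construct one, consider the averaging functionals
  \<open>x \<mapsto> (x(0) + \<dots> + x(n-1)) / n\<close>.  They lie in the product over all \<open>x\<close> of the intervals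
  \<open>[-\<parallel>x\<parallel>, \<parallel>x\<parallel>]\<close>, which is compact by Tychonoff's theorem, so they converge pointwise along some
  proper filter finer than \<open>n \<rightarrow> \<infinity>\<close>.  Linearity, positivity, normalisation and the bound by the norm
  pass to the limit.  The limit is shift invariant because the averages of \<open>x\<close> and of its shift
  differ by \<open>(x(0) - x(n)) / n\<close>, which vanishes in the limit.
\<close>

section \<open>Window averages\<close>

lemma apply_left_shift_funpow: "apply_bcontfun ((left_shift ^^ k) x) n = apply_bcontfun x (n + k)"
  by (induction k arbitrary: n) auto

lemma apply_bcontfun_sum:
  fixes f :: "'i \<Rightarrow> 'a::topological_space \<Rightarrow>\<^sub>C 'b::real_normed_vector"
  shows "apply_bcontfun (sum f A) x = (\<Sum>i\<in>A. apply_bcontfun (f i) x)"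
  by (induction A rule: infinite_finite_induct) auto

definition window_mean :: "nat \<Rightarrow> linf \<Rightarrow> linf" where
  "window_mean n x = (\<Sum>k<n. (left_shift ^^ k) x) /\<^sub>R real n"

lemma apply_window_mean:
  "apply_bcontfun (window_mean n x) i = (\<Sum>k<n. apply_bcontfun x (k + i)) / real n"
  by (simp add: window_mean_def apply_bcontfun_sum apply_left_shift_funpow add.commute
      divide_inverse mult.commute)

lemma abs_window_mean_le: "\<bar>apply_bcontfun (window_mean n x) i\<bar> \<le> norm x"
proof (cases "n = 0")
  case True
  then show ?thesis by (simp add: apply_window_mean)
next
  case False
  have "\<bar>\<Sum>k<n. apply_bcontfun x (k + i)\<bar> \<le> (\<Sum>k<n. norm x)"
    by (rule order_trans[OF sum_abs sum_mono]) (use norm_bounded[of x] in simp)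
  with False show ?thesis
    by (simp add: apply_window_mean field_simps)
qed

lemma window_mean_add: "window_mean n (x + y) = window_mean n x + window_mean n y"
  by (rule bcontfun_eqI) (simp add: apply_window_mean sum.distrib add_divide_distrib)

lemma window_mean_scaleR: "window_mean n (c *\<^sub>R x) = c *\<^sub>R window_mean n x"
  by (rule bcontfun_eqI) (simp add: apply_window_mean flip: sum_distrib_left)

text \<open>Two consecutive windows share all but one term at either end, so the sum telescopes.\<close>

lemma window_mean_diff_left_shift:
  "apply_bcontfun (window_mean n x) i - apply_bcontfun (window_mean n (left_shift x)) i =
     (apply_bcontfun x i - apply_bcontfun x (n + i)) / real n"
  using sum_lessThan_telescope'[of "\<lambda>k. apply_bcontfun x (k + i)" n]
  by (simp add: apply_window_mean sum_subtractf flip: diff_divide_distrib)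

section \<open>Shift-invariant functionals\<close>

text \<open>
  The principle behind both evaluations below: if \<open>L\<close> does not distinguish \<open>x\<close> from the terms of a
  sequence that converges in norm to a constant, then \<open>L x\<close> is this constant.
\<close>

lemma functional_eq_constant_limit:
  fixes L :: "linf \<Rightarrow> real"
  assumes L: "bounded_linear L" "L (const_bcontfun 1) = 1"
    and y: "y \<longlonglongrightarrow> const_bcontfun c" "\<forall>\<^sub>F n in sequentially. L (y n) = L x"
  shows "L x = c"
proof -
  interpret bounded_linear L by fact
  have "const_bcontfun c = c *\<^sub>R (const_bcontfun 1 :: linf)"
    by (rule bcontfun_eqI) simp
  then have "L (const_bcontfun c) = c"
    by (simp add: scaleR L)
  then have "(\<lambda>n. L (y n)) \<longlonglongrightarrow> c"
    using tendsto[OF y(1)] by simp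
  moreover have "(\<lambda>n. L (y n)) \<longlonglongrightarrow> L x"
    using y(2) by (rule tendsto_eventually)
  ultimately show ?thesis
    using LIMSEQ_unique by blast
qed

lemma shift_invariant_funpow:
  assumes "\<And>x. L (left_shift x) = L x"
  shows "L ((left_shift ^^ k) x) = L x"
  by (induction k) (simp_all add: assms)

lemma shift_invariant_window_mean:
  fixes L :: "linf \<Rightarrow> real"
  assumes "bounded_linear L" "\<And>x. L (left_shift x) = L x" "n > 0"
  shows "L (window_mean n x) = L x"
proof -
  interpret bounded_linear L by fact
  show ?thesis
    using \<open>n > 0\<close> shift_invariant_funpow[of L, OF assms(2)]
    by (simp add: window_mean_def scaleR sum)
qed

text \<open>
  Shifting a convergent sequence far enough discards the terms that are not yet close to the
  limit, so the iterated shifts converge in norm to a constant.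
\<close>

lemma shift_invariant_eq_limit:
  fixes L :: "linf \<Rightarrow> real"
  assumes L: "bounded_linear L" "\<And>x. L (left_shift x) = L x" "L (const_bcontfun 1) = 1"
    and x: "apply_bcontfun x \<longlonglongrightarrow> l"
  shows "L x = l"
proof (rule functional_eq_constant_limit[OF L(1,3)])
  have "uniform_limit UNIV (\<lambda>k. apply_bcontfun ((left_shift ^^ k) x))
          (apply_bcontfun (const_bcontfun l)) sequentially"
  proof (rule uniform_limitI)
    fix e :: real assume "e > 0"
    with x obtain N where "\<And>n. n \<ge> N \<Longrightarrow> dist (apply_bcontfun x n) l < e"
      by (auto simp: lim_sequentially)
    then have "\<forall>i. dist (apply_bcontfun ((left_shift ^^ k) x) i) (apply_bcontfun (const_bcontfun l) i) < e"
      if "k \<ge> N" for k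
      using that by (simp add: apply_left_shift_funpow)
    then show "\<forall>\<^sub>F k in sequentially. \<forall>i\<in>UNIV. dist (apply_bcontfun ((left_shift ^^ k) x) i)
        (apply_bcontfun (const_bcontfun l) i) < e"
      unfolding eventually_sequentially by blast
  qed
  then show "(\<lambda>k. (left_shift ^^ k) x) \<longlonglongrightarrow> const_bcontfun l"
    by (rule uniform_limit_tendsto_bcontfun)
  show "\<forall>\<^sub>F k in sequentially. L ((left_shift ^^ k) x) = L x"
    by (simp add: shift_invariant_funpow L)
qed

text \<open>
  Here the approximants are the window averages.  Uniformity in the starting point of the window is
  exactly convergence in the supremum norm, which is what continuity of \<open>L\<close> requires.
\<close>

lemma banach_limit_eq_uniform_window_mean_limit:
  assumes L: "banach_limit L"
    and x: "uniform_limit UNIV (\<lambda>n. apply_bcontfun (window_mean n x)) (\<lambda>i. c) sequentially"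
  shows "blinfun_apply L x = c"
proof (rule functional_eq_constant_limit)
  show "bounded_linear (blinfun_apply L)"
    by (rule blinfun.bounded_linear_right)
  show "blinfun_apply L (const_bcontfun 1) = 1"
    using L by (simp add: banach_limit_def)
  have "apply_bcontfun (const_bcontfun c) = (\<lambda>i::nat. c)"
    by (rule ext) simp
  with x show "(\<lambda>n. window_mean n x) \<longlonglongrightarrow> const_bcontfun c"
    by (intro uniform_limit_tendsto_bcontfun) simp
  show "\<forall>\<^sub>F n in sequentially. blinfun_apply L (window_mean n x) = blinfun_apply L x"
    using eventually_gt_at_top[of 0]
  proof eventually_elim
    case (elim n)
    show ?case
      by (rule shift_invariant_window_mean[OF blinfun.bounded_linear_right _ elim])
        (use L in \<open>simp add: banach_limit_def\<close>)
  qed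
qed

section \<open>Existence of Banach limits\<close>

text \<open>
  Tychonoff's theorem in the form needed here.  A cluster point in the product topology need not be
  the limit of a subsequence, so convergence takes place along a finer filter: the preimage of
  the neighbourhoods of the cluster point.
\<close>

lemma pointwise_bounded_cluster_filter:
  fixes C :: "'i \<Rightarrow> 'a \<Rightarrow> real"
  assumes bound: "\<And>i x. \<bar>C i x\<bar> \<le> b x" and "F \<noteq> bot"
  obtains G p where "G \<le> F" "G \<noteq> bot" "\<And>x. ((\<lambda>i. C i x) \<longlongrightarrow> p x) G"
proof -
  have "compactin (product_topology (\<lambda>x. euclidean) UNIV) (\<Pi>\<^sub>E x\<in>UNIV. {- b x..b x})"
    unfolding compactin_PiE by simp
  then have "compact (\<Pi>\<^sub>E x\<in>UNIV. {- b x..b x})"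
    by (simp add: euclidean_product_topology)
  moreover have "filtermap C F \<noteq> bot"
    using \<open>F \<noteq> bot\<close> by (simp add: filtermap_bot_iff)
  moreover have "\<forall>\<^sub>F f in filtermap C F. f \<in> (\<Pi>\<^sub>E x\<in>UNIV. {- b x..b x})"
    using bound by (auto simp: eventually_filtermap abs_le_iff minus_le_iff intro!: always_eventually)
  ultimately obtain p where p: "inf (nhds p) (filtermap C F) \<noteq> bot"
    unfolding compact_filter by blast
  define G where "G = inf F (filtercomap C (nhds p))"
  show ?thesis
  proof (rule that)
    show "G \<le> F"
      by (simp add: G_def)
    show "G \<noteq> bot"
    proof
      assume "G = bot"
      then obtain Q R where "eventually Q F" "eventually R (nhds p)" "\<And>i. Q i \<Longrightarrow> \<not> R (C i)"
        unfolding trivial_limit_def G_def eventually_inf eventually_filtercomap by blast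
      then have "\<forall>\<^sub>F f in filtermap C F. \<not> R f" "eventually R (nhds p)"
        by (auto simp: eventually_filtermap elim: eventually_mono)
      then have "\<forall>\<^sub>F f in inf (nhds p) (filtermap C F). False"
        unfolding eventually_inf by blast
      with p show False
        by (simp add: trivial_limit_def)
    qed
    fix x
    have "filterlim C (nhds p) G"
      unfolding G_def by (rule filterlim_mono[OF filterlim_filtercomap order_refl inf_le2])
    moreover have "continuous_on UNIV (\<lambda>f :: 'a \<Rightarrow> real. f x)"
      by (rule continuous_on_product_coordinates)
    then have "((\<lambda>f. f x) \<longlongrightarrow> p x) (nhds p)"
      using tendsto_at_iff_tendsto_nhds[of "\<lambda>f. f x" p] by (simp add: continuous_on_def)
    ultimately show "((\<lambda>i. C i x) \<longlongrightarrow> p x) G"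
      by (rule filterlim_compose[rotated])
  qed
qed

lemma banach_limit_exists: "\<exists>L. banach_limit L"
proof -
  define C where "C n x = apply_bcontfun (window_mean n x) 0" for n x
  obtain G p where G: "G \<le> sequentially" "G \<noteq> bot" and p: "\<And>x. ((\<lambda>n. C n x) \<longlongrightarrow> p x) G"
    using pointwise_bounded_cluster_filter[of C norm sequentially]
    by (auto simp: C_def abs_window_mean_le)
  note unique = tendsto_unique[OF G(2)]
  have add: "p (x + y) = p x + p y" for x y
    using tendsto_add[OF p p] p[of "x + y"] by (intro unique) (auto simp: C_def window_mean_add)
  have scale: "p (c *\<^sub>R x) = c *\<^sub>R p x" for c x
    using tendsto_scaleR[OF tendsto_const p] p[of "c *\<^sub>R x"]
    by (intro unique) (auto simp: C_def window_mean_scaleR)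
  have le: "\<bar>p x\<bar> \<le> norm x" for x
    by (rule tendsto_upperbound[OF tendsto_rabs[OF p] _ G(2)]) (simp add: C_def abs_window_mean_le)
  have linear: "bounded_linear p"
    by (rule bounded_linear_intro[where K = 1]) (simp_all add: add scale le[simplified])
  have nonneg: "p x \<ge> 0" if "\<And>n. apply_bcontfun x n \<ge> 0" for x
    by (rule tendsto_lowerbound[OF p _ G(2)])
      (simp add: C_def apply_window_mean sum_nonneg that)
  have one: "p (const_bcontfun 1) = 1"
  proof (rule unique[OF p tendsto_eventually])
    have "\<forall>\<^sub>F n in sequentially. C n (const_bcontfun 1) = 1"
      using eventually_gt_at_top[of 0] by eventually_elim (simp add: C_def apply_window_mean)
    with G(1) show "\<forall>\<^sub>F n in G. C n (const_bcontfun 1) = 1"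
      by (rule filter_leD)
  qed
  have shift: "p (left_shift x) = p x" for x
  proof -
    have "(\<lambda>n. C n x - C n (left_shift x)) \<longlonglongrightarrow> 0"
    proof (rule Lim_null_comparison)
      have "\<bar>apply_bcontfun x 0 - apply_bcontfun x n\<bar> \<le> 2 * norm x" for n
        using norm_bounded[of x 0] norm_bounded[of x n] by simp
      then show "\<forall>\<^sub>F n in sequentially. norm (C n x - C n (left_shift x)) \<le> 2 * norm x / real n"
        by (simp add: C_def window_mean_diff_left_shift divide_right_mono)
      show "(\<lambda>n. 2 * norm x / real n) \<longlonglongrightarrow> 0"
        by (rule lim_const_over_n)
    qed
    then have "((\<lambda>n. C n x - C n (left_shift x)) \<longlongrightarrow> 0) G"
      using G(1) by (rule filterlim_mono[OF _ order_refl])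
    then have "p x - p (left_shift x) = 0"
      by (rule unique[OF tendsto_diff[OF p p]])
    then show ?thesis by simp
  qed
  define L where "L = Blinfun p"
  have L: "blinfun_apply L = p"
    unfolding L_def by (rule bounded_linear_Blinfun_apply[OF linear])
  have "norm L \<le> 1"
    by (rule norm_blinfun_bound) (simp_all add: L le)
  moreover have "norm L \<ge> 1"
  proof -
    have "1 = norm (blinfun_apply L (const_bcontfun 1))"
      by (simp add: L one)
    also have "\<dots> \<le> norm L * norm (const_bcontfun 1 :: linf)"
      by (rule norm_blinfun)
    also have "\<dots> \<le> norm L * 1"
      by (intro mult_left_mono norm_bound) simp_all
    finally show ?thesis by simp
  qed
  ultimately have "banach_limit L"
    using nonneg shift one shift_invariant_eq_limit[OF linear shift one]
    by (simp add: banach_limit_def L)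
  then show ?thesis ..
qed

text \<open>
  Existence enters here: if there were no Banach limit, every real number would satisfy the
  description that defines the unique value.
\<close>

lemma almost_convergent_unique_banach_limitI:
  assumes "\<And>L. banach_limit L \<Longrightarrow> blinfun_apply L x = c"
  shows "almost_convergent x \<and> unique_banach_limit x = c"
proof
  show "almost_convergent x"
    by (simp add: almost_convergent_def assms)
  obtain L where "banach_limit L"
    using banach_limit_exists ..
  with assms show "unique_banach_limit x = c"
    unfolding unique_banach_limit_def by (intro the_equality) auto
qed

section \<open>Simply distributed sequences\<close>

lemma has_weight_weight:
  assumes "has_weight s a w"
  shows "has_weight s a (weight s a)"
  unfolding weight_def by (rule theI[where P = "has_weight s a", OF assms]) (rule has_weight_unique[OF _ assms])

text \<open>
  Grouping the terms of a window by their value turns the sum over positions into a sum over the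
  range; injectivity of \<open>a\<close> ensures that each value is counted once.
\<close>

lemma window_mean_eq_sum_window_freq:
  assumes "inj_on a J" "finite J" "range (apply_bcontfun s) = a ` J"
  shows "apply_bcontfun (window_mean n s) i = (\<Sum>j\<in>J. a j * window_freq s (a j) n i)"
proof -
  have "(\<Sum>k<n. apply_bcontfun s (k + i)) =
      (\<Sum>v\<in>a ` J. \<Sum>k | k \<in> {..<n} \<and> apply_bcontfun s (k + i) = v. apply_bcontfun s (k + i))"
    by (rule sum.group[symmetric]) (use assms in auto)
  also have "\<dots> = (\<Sum>v\<in>a ` J. v * real (card {k. k < n \<and> apply_bcontfun s (k + i) = v}))"
    by (rule sum.cong) (simp_all add: mult.commute)
  also have "\<dots> = (\<Sum>j\<in>J. a j * real (card {k. k < n \<and> apply_bcontfun s (k + i) = a j}))"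
    by (simp add: sum.reindex assms)
  finally show ?thesis
    by (simp add: apply_window_mean window_freq_def sum_divide_distrib)
qed

lemma uniform_limit_sum:
  fixes f :: "'j \<Rightarrow> 'n \<Rightarrow> 'x \<Rightarrow> 'b::real_normed_vector"
  assumes "\<And>j. j \<in> J \<Longrightarrow> uniform_limit X (f j) (l j) F"
  shows "uniform_limit X (\<lambda>n x. \<Sum>j\<in>J. f j n x) (\<lambda>x. \<Sum>j\<in>J. l j x) F"
  using assms
  by (induction J rule: infinite_finite_induct) (auto intro!: uniform_limit_add uniform_limit_const)

theorem theorem2p4:
  fixes s :: linf and a :: "nat \<Rightarrow> real" and m :: nat
  assumes "simply_distributed s"
    and "inj_on a {1..m}"
    and "range (apply_bcontfun s) = a ` {1..m}"
  shows "almost_convergent s \<and>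
         unique_banach_limit s = (\<Sum>j=1..m. a j * weight s (a j))"
proof (rule almost_convergent_unique_banach_limitI)
  fix L assume "banach_limit L"
  then show "blinfun_apply L s = (\<Sum>j=1..m. a j * weight s (a j))"
  proof (rule banach_limit_eq_uniform_window_mean_limit)
    have "uniform_limit UNIV (\<lambda>n i. a j * window_freq s (a j) n i)
        (\<lambda>i. a j * weight s (a j)) sequentially" if "j \<in> {1..m}" for j
    proof -
      from that have "a j \<in> range (apply_bcontfun s)"
        unfolding assms(3) by (rule imageI)
      then obtain w where "has_weight s (a j) w"
        using assms(1) unfolding simply_distributed_def by blast
      then have "has_weight s (a j) (weight s (a j))"
        by (rule has_weight_weight)
      then show ?thesis
        unfolding has_weight_def
        by (rule bounded_linear.uniform_limit[OF bounded_linear_mult_right])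
    qed
    then have "uniform_limit UNIV (\<lambda>n i. \<Sum>j=1..m. a j * window_freq s (a j) n i)
        (\<lambda>i. \<Sum>j=1..m. a j * weight s (a j)) sequentially"
      by (rule uniform_limit_sum)
    moreover have "(\<lambda>n. apply_bcontfun (window_mean n s)) =
        (\<lambda>n i. \<Sum>j=1..m. a j * window_freq s (a j) n i)"
      by (intro ext window_mean_eq_sum_window_freq assms) simp
    ultimately show "uniform_limit UNIV (\<lambda>n. apply_bcontfun (window_mean n s))
        (\<lambda>i. \<Sum>j=1..m. a j * weight s (a j)) sequentially"
      by simp
  qed
qed

end
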